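(* Let $d\ge 2$ and let $f : [0,1]^d \rightarrow \mathbb{R}^d$ be a continuous function with the following properties: (1) for all $i \in \{1, \dots, d\}$ and all $x \in [0,1]^d$ with $x_i = 0$, $(f(x))_i \leq 0$; (2) for all $i \in \{1, \dots, d\}$ and all $x \in [0,1]^d$ with $x_i = 1$, $(f(x))_i \geq 1$. Then $f([0,1]^d) \supset [0,1]^d$.
   Context: For $y\in\mathbb{R}^d$, $y_i$ (also written $(y)_i$) denotes its $i$th coordinate. *)

theory Defs
  imports "HOL-Analysis.Analysis"
begin

end

(* For a target y in the cube, project x + y - f x coordinatewise back to the cube and take a Brouwer
   fixed point x. At coordinates where the projection acts trivially, f x and y agree there. If it
   truncates at 0 then x $ i = 0 and f x $ i > y $ i, against the face condition; likewise at 1. *)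
theory Submission
  imports Defs
begin

theorem lemma2p11:
  fixes f :: "real ^ 'd \<Rightarrow> real ^ 'd"
  assumes "CARD('d) \<ge> 2"
    and "continuous_on (cbox 0 1) f"
    and "\<And>i x. x \<in> cbox 0 1 \<Longrightarrow> x $ i = 0 \<Longrightarrow> f x $ i \<le> 0"
    and "\<And>i x. x \<in> cbox 0 1 \<Longrightarrow> x $ i = 1 \<Longrightarrow> f x $ i \<ge> 1"
  shows "cbox 0 1 \<subseteq> f ` cbox 0 1"
proof
  fix y :: "real ^ 'd"
  assume y: "y \<in> cbox 0 1"
  \<comment> \<open>Fixed points of \<open>x + y - f x\<close> are exactly the solutions of
    \<open>f x = y\<close>; since this map may leave the cube, \<open>max\<close> and
    \<open>min\<close> clamp it.\<close>
  define g where "g x = (\<chi> i. max 0 (min 1 (x $ i + y $ i - f x $ i)))" for x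
  have "continuous_on (cbox 0 1) g"
    unfolding g_def by (intro continuous_intros assms(2))
  moreover have "g \<in> cbox 0 1 \<rightarrow> cbox 0 1"
    by (auto simp: g_def mem_box_cart)
  moreover have "cbox 0 1 \<noteq> ({} :: (real ^ 'd) set)"
    using y by blast
  ultimately obtain x where x: "x \<in> cbox 0 1" and fixed: "g x = x"
    using brouwer[OF compact_cbox convex_box(1)] by metis
  have "f x $ i = y $ i" for i
  proof -
    have "x $ i = max 0 (min 1 (x $ i + y $ i - f x $ i))"
      using arg_cong[OF fixed, of "\<lambda>v. v $ i"] by (simp add: g_def)
    \<comment> \<open>These bounds settle the truncated cases:
      \<open>f x $ i > y $ i \<ge> 0\<close> is impossible where \<open>x $ i = 0\<close>, and
      \<open>f x $ i < y $ i \<le> 1\<close> where \<open>x $ i = 1\<close>.\<close>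
    moreover have "0 \<le> y $ i" "y $ i \<le> 1"
      using y by (simp_all add: mem_box_cart)
    ultimately show ?thesis
      using assms(3)[OF x, of i] assms(4)[OF x, of i] by linarith
  qed
  then have "f x = y"
    by (simp add: vec_eq_iff)
  then show "y \<in> f ` cbox 0 1"
    using x by blast
qed

end
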